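(* Let $(P,\le,0,1)$ be a bounded poset satisfying the ACC and the DCC. Define binary operators $\sqcup,\sqcap$ on $P$ by $x\sqcup y:=\operatorname{Min}U(x,y)$ and $x\sqcap y:=\operatorname{Max}L(x,y)$, extended to subsets $A,B\subseteq P$ by $A\sqcup B:=\operatorname{Min}U(A\cup B)$ and $A\sqcap B:=\operatorname{Max}L(A\cup B)$ (elements being identified with singletons). Then $(P,\sqcup,\sqcap,0,1)$ is an operator structure.
   Context: ACC/DCC: no infinite strictly ascending/descending chains. For $A\subseteq P$: $L(A)=\{x\mid x\le a\ \forall a\in A\}$, $U(A)=\{x\mid a\le x\ \forall a\in A\}$, $\operatorname{Max}$, $\operatorname{Min}$ denote sets of maximal/minimal elements; $L(x,y)=L(\{x,y\})$, $\operatorname{Max}L(x,y)=\operatorname{Max}(L(\{x,y\}))$, etc. A binary operator on $P$ assigns to each pair of elements (and, by extension, to each pair of subsets) a subset of $P$; elements are identified with singletons, so e.g. "$x\sqcup y=y$" means $x\sqcup y=\{y\}$. An operator structure is $(P,\sqcup,\sqcap,0,1)$ with binary operators $\sqcup,\sqcap$ on $P$ and $0,1\in P$ such that for all $x,y,z\in P$: (i) $x\sqcup x=x$ and $x\sqcap x=x$; (ii) $x\sqcup y=y\sqcup x$ and $x\sqcap y=y\sqcap x$; (iii) $0\sqcup x=x$ and $x\sqcap 1=x$; (iv) $x\sqcup((x\sqcup y)\sqcup z)=0\sqcup((x\sqcup y)\sqcup z)$ and $x\sqcap((x\sqcap y)\sqcap z)=((x\sqcap y)\sqcap z)\sqcap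 1$; (v) $(x\sqcap y)\sqcup y=y$ and $x\sqcap(x\sqcup y)=x$; (vi) $z\in x\sqcup y$ if and only if [$x\sqcup z=y\sqcup z=z$, and for every $u\in P$ with $x\sqcup u=y\sqcup u=u\sqcap z=u$ we have $u=z$]; and $z\in x\sqcap y$ if and only if [$z\sqcap x=z\sqcap y=z$, and for every $u\in P$ with $u\sqcap x=u\sqcap y=z\sqcup u=u$ we have $u=z$]. *)

theory Defs
  imports Main
begin

definition upper_cone :: "'a::order set \<Rightarrow> 'a set" where
  "upper_cone A = {x. \<forall>a\<in>A. a \<le> x}"

definition lower_cone :: "'a::order set \<Rightarrow> 'a set" where
  "lower_cone A = {x. \<forall>a\<in>A. x \<le> a}"

definition minimals :: "'a::order set \<Rightarrow> 'a set" where
  "minimals A = {x \<in> A. \<not> (\<exists>y\<in>A. y < x)}"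

definition maximals :: "'a::order set \<Rightarrow> 'a set" where
  "maximals A = {x \<in> A. \<not> (\<exists>y\<in>A. x < y)}"

text \<open>
  A binary operator is represented by its extension to subsets. An element \<open>x\<close> is identified with
  the singleton \<open>{x}\<close>, so the value on a pair of elements is the value on the two singletons.
\<close>

definition join_op :: "'a::order set \<Rightarrow> 'a set \<Rightarrow> 'a set" where
  "join_op A B = minimals (upper_cone (A \<union> B))"

definition meet_op :: "'a::order set \<Rightarrow> 'a set \<Rightarrow> 'a set" where
  "meet_op A B = maximals (lower_cone (A \<union> B))"

lemma join_op_elements: "join_op {x} {y} = minimals (upper_cone {x, y})"
  by (simp add: join_op_def insert_commute)

lemma meet_op_elements: "meet_op {x} {y} = maximals (lower_cone {x, y})"
  by (simp add: meet_op_def insert_commute)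

text \<open>
  The underlying set is the whole type \<open>'a\<close>, on which no order is assumed.
\<close>

locale operator_structure =
  fixes join :: "'a set \<Rightarrow> 'a set \<Rightarrow> 'a set"  (infixl \<open>\<squnion>\<close> 65)
    and meet :: "'a set \<Rightarrow> 'a set \<Rightarrow> 'a set"  (infixl \<open>\<sqinter>\<close> 70)
    and zero :: 'a  (\<open>\<zero>\<close>)
    and one :: 'a  (\<open>\<one>\<close>)
  assumes join_idem: "{x} \<squnion> {x} = {x}"
    and meet_idem: "{x} \<sqinter> {x} = {x}"
    and join_comm: "{x} \<squnion> {y} = {y} \<squnion> {x}"
    and meet_comm: "{x} \<sqinter> {y} = {y} \<sqinter> {x}"
    and zero_join: "{\<zero>} \<squnion> {x} = {x}"
    and meet_one: "{x} \<sqinter> {\<one>} = {x}"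
    and join_assoc: "{x} \<squnion> (({x} \<squnion> {y}) \<squnion> {z}) = {\<zero>} \<squnion> (({x} \<squnion> {y}) \<squnion> {z})"
    and meet_assoc: "{x} \<sqinter> (({x} \<sqinter> {y}) \<sqinter> {z}) = (({x} \<sqinter> {y}) \<sqinter> {z}) \<sqinter> {\<one>}"
    and meet_join_absorb: "({x} \<sqinter> {y}) \<squnion> {y} = {y}"
    and join_meet_absorb: "{x} \<sqinter> ({x} \<squnion> {y}) = {x}"
    and mem_join_iff: "z \<in> {x} \<squnion> {y} \<longleftrightarrow>
      {x} \<squnion> {z} = {z} \<and> {y} \<squnion> {z} = {z} \<and>
      (\<forall>u. {x} \<squnion> {u} = {u} \<and> {y} \<squnion> {u} = {u} \<and> {u} \<sqinter> {z} = {u} \<longrightarrow> u = z)"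
    and mem_meet_iff: "z \<in> {x} \<sqinter> {y} \<longleftrightarrow>
      {z} \<sqinter> {x} = {z} \<and> {z} \<sqinter> {y} = {z} \<and>
      (\<forall>u. {u} \<sqinter> {x} = {u} \<and> {u} \<sqinter> {y} = {u} \<and> {z} \<squnion> {u} = {u} \<longrightarrow> u = z)"

end

theory Submission imports Defs begin

text \<open>The operators recover the order: \<open>join_op_eq_singleton_iff\<close> and
  \<open>meet_op_eq_singleton_iff\<close> turn each equation in the last two axioms into an
  inequality, after which those axioms just spell out minimality and maximality. The chain
  conditions matter for the associativity-like laws: by \<open>join_op_nonempty\<close>, S =
  \<open>join_op (join_op {x} {y}) {z}\<close> contains some s, and s lies above x through an
  element of \<open>join_op {x} {y}\<close>. Hence adjoining x to S, or adjoining
  \<open>bot\<close>, leaves the upper cone of S unchanged. The meet law is dual.\<close>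

lemma join_op_eq_singleton_iff: "join_op {x} {y} = {y} \<longleftrightarrow> x \<le> y"
  unfolding join_op_elements minimals_def upper_cone_def
  by (auto simp: less_le_not_le)

lemma meet_op_eq_singleton_iff: "meet_op {x} {y} = {x} \<longleftrightarrow> x \<le> y"
  unfolding meet_op_elements maximals_def lower_cone_def
  by (auto simp: less_le_not_le)

lemma join_op_commute: "join_op A B = join_op B A"
  by (simp add: join_op_def Un_commute)

lemma meet_op_commute: "meet_op A B = meet_op B A"
  by (simp add: meet_op_def Un_commute)

text \<open>The upper cone of A together with y is the principal up-set of y, whose only minimal
  element is y. No element of A is needed, so A may be empty.\<close>

lemma join_op_absorb:
  assumes "\<And>a. a \<in> A \<Longrightarrow> a \<le> y"
  shows "join_op A {y} = {y}"
  using assms unfolding join_op_def minimals_def upper_cone_def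
  by (auto simp: less_le_not_le)

lemma meet_op_absorb:
  assumes "\<And>b. b \<in> B \<Longrightarrow> x \<le> b"
  shows "meet_op {x} B = {x}"
  using assms unfolding meet_op_def maximals_def lower_cone_def
  by (auto simp: less_le_not_le)

lemma join_op_ge: "a \<in> A \<union> B \<Longrightarrow> w \<in> join_op A B \<Longrightarrow> a \<le> w"
  by (simp add: join_op_def minimals_def upper_cone_def)

lemma meet_op_le: "a \<in> A \<union> B \<Longrightarrow> w \<in> meet_op A B \<Longrightarrow> w \<le> a"
  by (simp add: meet_op_def maximals_def lower_cone_def)

text \<open>The cone contains \<open>top\<close>, and DCC makes the strict order well-founded, so
  the cone has a minimal element.\<close>

lemma join_op_nonempty:
  fixes A B :: "'a::order_top set"
  assumes DCC: "\<not> (\<exists>c :: nat \<Rightarrow> 'a. \<forall>i. c (Suc i) < c i)"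
  shows "join_op A B \<noteq> {}"
proof -
  have "wf {(x, y :: 'a). x < y}"
    using DCC by (simp add: wf_iff_no_infinite_down_chain)
  moreover have "top \<in> upper_cone (A \<union> B)"
    by (simp add: upper_cone_def)
  ultimately obtain m where "m \<in> upper_cone (A \<union> B)"
    and "\<And>y. (y, m) \<in> {(x, y). x < y} \<Longrightarrow> y \<notin> upper_cone (A \<union> B)"
    by (rule wfE_min) blast
  then have "m \<in> join_op A B"
    by (auto simp: join_op_def minimals_def)
  then show ?thesis by blast
qed

lemma meet_op_nonempty:
  fixes A B :: "'a::order_bot set"
  assumes ACC: "\<not> (\<exists>c :: nat \<Rightarrow> 'a. \<forall>i. c i < c (Suc i))"
  shows "meet_op A B \<noteq> {}"
proof -
  have "wf {(x, y :: 'a). y < x}"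
    using ACC by (simp add: wf_iff_no_infinite_down_chain)
  moreover have "bot \<in> lower_cone (A \<union> B)"
    by (simp add: lower_cone_def)
  ultimately obtain m where "m \<in> lower_cone (A \<union> B)"
    and "\<And>y. (y, m) \<in> {(x, y). y < x} \<Longrightarrow> y \<notin> lower_cone (A \<union> B)"
    by (rule wfE_min) blast
  then have "m \<in> meet_op A B"
    by (auto simp: meet_op_def maximals_def)
  then show ?thesis by blast
qed

text \<open>Upper bounds of S lie above s, hence above x, so x adds no constraint. The right-hand
  side is free of x, which lets two different choices of x be compared.\<close>

lemma join_op_below:
  assumes "s \<in> S" and "x \<le> s"
  shows "join_op {x} S = join_op S S"
proof -
  have "upper_cone ({x} \<union> S) = upper_cone (S \<union> S)"
    using assms by (auto simp: upper_cone_def intro: order_trans)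
  then show ?thesis by (simp add: join_op_def)
qed

lemma meet_op_above:
  assumes "s \<in> S" and "s \<le> x"
  shows "meet_op {x} S = meet_op S S"
proof -
  have "lower_cone ({x} \<union> S) = lower_cone (S \<union> S)"
    using assms by (auto simp: lower_cone_def intro: order_trans)
  then show ?thesis by (simp add: meet_op_def)
qed

text \<open>Minimality is phrased with u \<le> z and u = z, rather than with the strict order, to
  match the shape of the axiom literally.\<close>

lemma mem_join_op_iff:
  "z \<in> join_op {x} {y} \<longleftrightarrow>
    x \<le> z \<and> y \<le> z \<and> (\<forall>u. x \<le> u \<and> y \<le> u \<and> u \<le> z \<longrightarrow> u = z)"
  by (auto simp: join_op_elements minimals_def upper_cone_def less_le)

lemma mem_meet_op_iff:
  "z \<in> meet_op {x} {y} \<longleftrightarrow>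
    z \<le> x \<and> z \<le> y \<and> (\<forall>u. u \<le> x \<and> u \<le> y \<and> z \<le> u \<longrightarrow> u = z)"
  by (auto simp: meet_op_elements maximals_def lower_cone_def less_le)

theorem theorem3p2:
  assumes ACC: "\<not> (\<exists>c :: nat \<Rightarrow> 'a::{order_bot,order_top}. \<forall>i. c i < c (Suc i))"
    and DCC: "\<not> (\<exists>c :: nat \<Rightarrow> 'a. \<forall>i. c (Suc i) < c i)"
  shows "operator_structure (join_op :: 'a set \<Rightarrow> 'a set \<Rightarrow> 'a set) meet_op bot top"
proof
  fix x y z :: 'a
  show "join_op {x} {x} = {x}" "join_op {bot} {x} = {x}"
    by (simp_all add: join_op_eq_singleton_iff)
  show "meet_op {x} {x} = {x}" "meet_op {x} {top} = {x}"
    by (simp_all add: meet_op_eq_singleton_iff)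
  show "join_op {x} {y} = join_op {y} {x}" by (rule join_op_commute)
  show "meet_op {x} {y} = meet_op {y} {x}" by (rule meet_op_commute)
  show "join_op {x} (join_op (join_op {x} {y}) {z}) =
      join_op {bot} (join_op (join_op {x} {y}) {z})"
  proof -
    obtain w where w: "w \<in> join_op {x} {y}"
      using join_op_nonempty[OF DCC] by blast
    obtain s where s: "s \<in> join_op (join_op {x} {y}) {z}"
      using join_op_nonempty[OF DCC] by blast
    have "x \<le> w" using w by (auto intro: join_op_ge)
    also have "w \<le> s" using w s by (auto intro: join_op_ge)
    \<comment> \<open>Both sides collapse to the same join of S with itself, since x and
      \<open>bot\<close> both lie below s.\<close>
    finally show ?thesis by (simp add: join_op_below[OF s])
  qed
  show "meet_op {x} (meet_op (meet_op {x} {y}) {z}) =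
      meet_op (meet_op (meet_op {x} {y}) {z}) {top}"
  proof -
    obtain w where w: "w \<in> meet_op {x} {y}"
      using meet_op_nonempty[OF ACC] by blast
    obtain s where s: "s \<in> meet_op (meet_op {x} {y}) {z}"
      using meet_op_nonempty[OF ACC] by blast
    have "s \<le> w" using w s by (auto intro: meet_op_le)
    also have "w \<le> x" using w by (auto intro: meet_op_le)
    finally show ?thesis
      \<comment> \<open>Commutativity brings \<open>{top}\<close> to the left, where
        \<open>meet_op_above\<close> applies to it as it does to x.\<close>
      by (simp add: meet_op_above[OF s] meet_op_commute[of _ "{top}"])
  qed
  show "join_op (meet_op {x} {y}) {y} = {y}"
    by (rule join_op_absorb) (auto intro: meet_op_le)
  show "meet_op {x} (join_op {x} {y}) = {x}"
    by (rule meet_op_absorb) (auto intro: join_op_ge)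
  show "z \<in> join_op {x} {y} \<longleftrightarrow>
      join_op {x} {z} = {z} \<and> join_op {y} {z} = {z} \<and>
      (\<forall>u. join_op {x} {u} = {u} \<and> join_op {y} {u} = {u} \<and> meet_op {u} {z} = {u} \<longrightarrow> u = z)"
    \<comment> \<open>Once the operator equations are read as inequalities, the two sides
      coincide.\<close>
    by (simp only: mem_join_op_iff join_op_eq_singleton_iff meet_op_eq_singleton_iff)
  show "z \<in> meet_op {x} {y} \<longleftrightarrow>
      meet_op {z} {x} = {z} \<and> meet_op {z} {y} = {z} \<and>
      (\<forall>u. meet_op {u} {x} = {u} \<and> meet_op {u} {y} = {u} \<and> join_op {z} {u} = {u} \<longrightarrow> u = z)"
    by (simp only: mem_meet_op_iff join_op_eq_singleton_iff meet_op_eq_singleton_iff)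
qed

end
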